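(* Let $C$ be a commutative unital ring, let $\mathfrak{G}$ be the generalized Grassmann algebra over $C$, and let $n\ge 1$. The $n$-th co-module $P_n/(\operatorname{id}(\mathfrak{G})\cap P_n)$ of $\mathfrak{G}$ is isomorphic, as an $S_n$-module (that is, as a $C[S_n]$-module), to the module of generalized signs $C[\varepsilon]_n$.
   Context: $[a,b]=ab-ba$. $C\langle X\rangle$ is the free associative $C$-algebra on a countably infinite alphabet $X=\{x_1,x_2,\dots\}$. For a $C$-algebra $A$, $\operatorname{id}(A)\subseteq C\langle X\rangle$ is the set of all polynomials vanishing under all substitutions of elements of $A$. $P_n=\{\sum_{\sigma\in S_n}\alpha_\sigma x_{\sigma(1)}\cdots x_{\sigma(n)} : \alpha_\sigma\in C\}$ is the space of multilinear polynomials in $x_1,\dots,x_n$, with $S_n$-action $\tau\cdot x_{\sigma(1)}\cdots x_{\sigma(n)}=x_{\tau\sigma(1)}\cdots x_{\tau\sigma(n)}$; $\operatorname{id}(A)\cap P_n$ is an $S_n$-submodule. $C[\varepsilon]$ denotes the commutative unital $C$-algebra $C[\theta,\varepsilon_1,\varepsilon_2,\dots]$ subject to the relations $\theta^2=2$ and $\varepsilon_i^2=\theta\varepsilon_i$ for all $i$. The generalized Grassmann algebra $\mathfrak{G}$ over $C$ is the unital algebra generated by $e_1,e_2,\dots$ over the central subring $C[\varepsilon]$, subject to the relations $[e_i,e_j]=\varepsilon_i\varepsilon_j e_ie_j$ for all $i,j$ (including $i=j$). For $\sigma\in S_n$ let $\phi_\sigma$ be the $C$-algebra automorphism of $C[\varepsilon]$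 with $\phi_\sigma(\theta)=\theta$ and $\phi_\sigma(\varepsilon_i)=\varepsilon_{\sigma(i)}$ (with $\sigma(i)=i$ for $i>n$). For $w=(e_1,\dots,e_n)$, the generalized sign of $\sigma\in S_n$ is $$\mathfrak{sgn}_w(\sigma)=\prod_{i<j,\ \sigma(i)>\sigma(j)}\bigl(1-\varepsilon_{\sigma(i)}\varepsilon_{\sigma(j)}\bigr)\in C[\varepsilon].$$ $S_n$ acts $C$-linearly on $C[\varepsilon]$ by $\sigma(\lambda)=\mathfrak{sgn}_w(\sigma)\,\phi_\sigma(\lambda)$ (this is a group action), and $C[\varepsilon]_n$ is the $S_n$-submodule (i.e. $C[S_n]$-submodule) of $C[\varepsilon]$ generated by $1\in C[\varepsilon]$. *)

theory Defs
  imports "HOL-Library.Poly_Mapping" "HOL-Combinatorics.Permutations"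
begin

text \<open>
  Conventions. The alphabet and the two families of generators are indexed by \<open>nat\<close> starting at
  \<open>0\<close>, so \<open>x\<^sub>1, x\<^sub>2, \<dots>\<close> become the letters \<open>0, 1, \<dots>\<close>, and the symmetric group on \<open>n\<close> points
  is the set of all \<open>\<sigma>\<close> with \<open>\<sigma> permutes {..<n}\<close>; such \<open>\<sigma>\<close> fix every index \<open>\<ge> n\<close>.

  A commutative unital ring is a type of sort \<open>{comm_ring, comm_monoid_mult}\<close>. This is
  \<open>comm_ring_1\<close> without the axiom \<open>0 \<noteq> 1\<close>, so the zero ring is allowed. Similarly
  \<open>{ring, monoid_mult}\<close> is \<open>ring_1\<close> without \<open>0 \<noteq> 1\<close>. Since the unit of a
  \<open>poly_mapping\<close> ring is only declared under \<open>0 \<noteq> 1\<close>, it is written \<open>single 0 1\<close> below.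
\<close>

subsection \<open>Finitely supported functions\<close>

definition push :: "('a \<Rightarrow> 'b) \<Rightarrow> ('a \<Rightarrow>\<^sub>0 'r) \<Rightarrow> ('b \<Rightarrow>\<^sub>0 'r::comm_monoid_add)"
  where "push f p = (\<Sum>k\<in>Poly_Mapping.keys p. Poly_Mapping.single (f k) (Poly_Mapping.lookup p k))"

lemma pm_expand: "p = (\<Sum>k\<in>Poly_Mapping.keys p. Poly_Mapping.single k (Poly_Mapping.lookup p k))"
  by (rule poly_mapping_eqI)
    (auto simp: lookup_sum lookup_single when_def in_keys_iff)

lemma pm_induct [case_names zero single add]:
  assumes "P 0" "\<And>k c. P (Poly_Mapping.single k c)" "\<And>p q. P p \<Longrightarrow> P q \<Longrightarrow> P (p + q)"
  shows "P (p :: 'a \<Rightarrow>\<^sub>0 'r::comm_monoid_add)"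
proof -
  have "P (\<Sum>k\<in>A. Poly_Mapping.single k (Poly_Mapping.lookup p k))" if "finite A" for A
    using that by (induction A) (auto intro: assms)
  then show ?thesis
    using pm_expand[of p] by (metis finite_keys)
qed

lemma push_superset:
  assumes "finite A" "Poly_Mapping.keys p \<subseteq> A"
  shows "push f p = (\<Sum>k\<in>A. Poly_Mapping.single (f k) (Poly_Mapping.lookup p k))"
  unfolding push_def by (rule sum.mono_neutral_left) (use assms in \<open>auto simp: in_keys_iff\<close>)

lemma push_zero [simp]: "push f 0 = 0"
  by (simp add: push_def)

lemma push_single [simp]: "push f (Poly_Mapping.single k c) = Poly_Mapping.single (f k) c"
  by (cases "c = 0") (simp_all add: push_def)

lemma push_add: "push f (p + q) = push f p + push f q"
proof -
  let ?A = "Poly_Mapping.keys p \<union> Poly_Mapping.keys q"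
  have "push f (p + q)
      = (\<Sum>k\<in>?A. Poly_Mapping.single (f k) (Poly_Mapping.lookup (p + q) k))"
    by (rule push_superset) (auto simp: keys_add)
  also have "\<dots> = push f p + push f q"
    by (simp add: push_superset[of ?A p] push_superset[of ?A q] lookup_add single_add sum.distrib)
  finally show ?thesis .
qed

lemma push_diff: "push f (p - q) = push f p - push f (q :: 'a \<Rightarrow>\<^sub>0 'r::ab_group_add)"
  by (metis add_diff_cancel diff_add_cancel push_add)

lemma push_mult:
  fixes p q :: "'a::monoid_add \<Rightarrow>\<^sub>0 'r::semiring_0"
  assumes f: "\<And>a b. f (a + b) = f a + (f b :: 'b::monoid_add)"
  shows "push f (p * q) = push f p * push f q"
proof (induction p rule: pm_induct)
  case (single k c)
  show ?case
    by (induction q rule: pm_induct) (simp_all add: mult_single f distrib_left push_add)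
qed (simp_all add: distrib_right push_add)

lemma single_one_mult [simp]:
  fixes p :: "'a::monoid_add \<Rightarrow>\<^sub>0 'r::{semiring_0, monoid_mult}"
  shows "Poly_Mapping.single 0 1 * p = p" "p * Poly_Mapping.single 0 1 = p"
  by (induction p rule: pm_induct) (simp_all add: mult_single distrib_left distrib_right)

subsection \<open>Two-sided ideals\<close>

inductive_set ideal_gen :: "'a::ring set \<Rightarrow> 'a set" for R :: "'a set"
  where
    ideal_gen_zero: "0 \<in> ideal_gen R"
  | ideal_gen_base: "r \<in> R \<Longrightarrow> r \<in> ideal_gen R"
  | ideal_gen_diff: "a \<in> ideal_gen R \<Longrightarrow> b \<in> ideal_gen R \<Longrightarrow> a - b \<in> ideal_gen R"
  | ideal_gen_left: "a \<in> ideal_gen R \<Longrightarrow> r * a \<in> ideal_gen R"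
  | ideal_gen_right: "a \<in> ideal_gen R \<Longrightarrow> a * r \<in> ideal_gen R"

lemma ideal_gen_uminus: "a \<in> ideal_gen R \<Longrightarrow> - a \<in> ideal_gen R"
  using ideal_gen_diff[OF ideal_gen_zero] by fastforce

lemma ideal_gen_add: "a \<in> ideal_gen R \<Longrightarrow> b \<in> ideal_gen R \<Longrightarrow> a + b \<in> ideal_gen R"
  using ideal_gen_diff[OF _ ideal_gen_uminus] by fastforce

lemma ideal_gen_equivp: "equivp (\<lambda>a b. a - b \<in> ideal_gen R)"
proof (rule equivpI)
  show "reflp (\<lambda>a b. a - b \<in> ideal_gen R)"
    by (simp add: reflpI ideal_gen_zero)
  show "symp (\<lambda>a b. a - b \<in> ideal_gen R)"
    by (rule sympI) (use ideal_gen_uminus in fastforce)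
  show "transp (\<lambda>a b. a - b \<in> ideal_gen R)"
    proof (rule transpI)
    fix a b c assume "a - b \<in> ideal_gen R" "b - c \<in> ideal_gen R"
    from ideal_gen_add[OF this] show "a - c \<in> ideal_gen R" by simp
  qed
qed

lemma ideal_gen_cong_add:
  "a - a' \<in> ideal_gen R \<Longrightarrow> b - b' \<in> ideal_gen R \<Longrightarrow> (a + b) - (a' + b') \<in> ideal_gen R"
  using ideal_gen_add[of "a - a'" R "b - b'"] by (simp add: algebra_simps)

lemma ideal_gen_cong_diff:
  "a - a' \<in> ideal_gen R \<Longrightarrow> b - b' \<in> ideal_gen R \<Longrightarrow> (a - b) - (a' - b') \<in> ideal_gen R"
  using ideal_gen_diff[of "a - a'" R "b - b'"] by (simp add: algebra_simps)

lemma ideal_gen_cong_uminus: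
  "a - a' \<in> ideal_gen R \<Longrightarrow> (- a) - (- a') \<in> ideal_gen R"
  using ideal_gen_uminus[of "a - a'" R] by simp

lemma ideal_gen_cong_mult:
  assumes "a - a' \<in> ideal_gen R" "b - b' \<in> ideal_gen R"
  shows "a * b - a' * b' \<in> ideal_gen R"
proof -
  have "(a - a') * b + a' * (b - b') \<in> ideal_gen R"
    using assms by (intro ideal_gen_add ideal_gen_left ideal_gen_right)
  then show ?thesis by (simp add: algebra_simps)
qed

subsection \<open>The coefficient ring \<open>C[\<epsilon>]\<close>\<close>

datatype cvar = Theta | Eps nat

text \<open>Monomials are exponent functions, so \<open>'c cpoly\<close> is the polynomial ring \<open>C[\<theta>, \<epsilon>\<^sub>0, \<epsilon>\<^sub>1, \<dots>]\<close>.\<close>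

type_synonym 'c cpoly = "(cvar \<Rightarrow>\<^sub>0 nat) \<Rightarrow>\<^sub>0 'c"

abbreviation Cvar :: "cvar \<Rightarrow> 'c::{comm_ring, comm_monoid_mult} cpoly"
  where "Cvar v \<equiv> Poly_Mapping.single (Poly_Mapping.single v 1) 1"

definition ceps_rels :: "'c::{comm_ring, comm_monoid_mult} cpoly set"
  where "ceps_rels = {Cvar Theta * Cvar Theta - Poly_Mapping.single 0 (1 + 1)}
    \<union> {Cvar (Eps i) * Cvar (Eps i) - Cvar Theta * Cvar (Eps i) | i. True}"

quotient_type (overloaded) 'c ceps = "'c::{comm_ring, comm_monoid_mult} cpoly"
  / "\<lambda>p q. p - q \<in> ideal_gen ceps_rels"
  by (rule ideal_gen_equivp)

instantiation ceps :: ("{comm_ring, comm_monoid_mult}") "{comm_ring, comm_monoid_mult}"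
begin

lift_definition zero_ceps :: "'a ceps" is "0" .
lift_definition one_ceps :: "'a ceps" is "Poly_Mapping.single 0 1" .
lift_definition plus_ceps :: "'a ceps \<Rightarrow> 'a ceps \<Rightarrow> 'a ceps" is "(+)"
  by (rule ideal_gen_cong_add)
lift_definition minus_ceps :: "'a ceps \<Rightarrow> 'a ceps \<Rightarrow> 'a ceps" is "(-)"
  by (rule ideal_gen_cong_diff)
lift_definition uminus_ceps :: "'a ceps \<Rightarrow> 'a ceps" is "uminus"
  by (rule ideal_gen_cong_uminus)
lift_definition times_ceps :: "'a ceps \<Rightarrow> 'a ceps \<Rightarrow> 'a ceps" is "(*)"
  by (rule ideal_gen_cong_mult)

instance
  by standard (transfer; simp add: algebra_simps ideal_gen_zero)+

end

lift_definition theta :: "'c::{comm_ring, comm_monoid_mult} ceps" is "Cvar Theta" .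

lift_definition eps :: "nat \<Rightarrow> 'c::{comm_ring, comm_monoid_mult} ceps" is "\<lambda>i. Cvar (Eps i)" .

lift_definition ceps_of :: "'c::{comm_ring, comm_monoid_mult} \<Rightarrow> 'c ceps"
  is "Poly_Mapping.single 0" .

text \<open>\<open>\<phi>\<^sub>\<sigma>\<close> substitutes \<open>\<epsilon>\<^bsub>\<sigma> i\<^esub>\<close> for \<open>\<epsilon>\<^sub>i\<close>: the inner \<open>push\<close> renames the variables in a monomial,
  the outer one extends this linearly to polynomials.\<close>

definition ren :: "(nat \<Rightarrow> nat) \<Rightarrow> cvar \<Rightarrow> cvar"
  where "ren \<sigma> v = (case v of Theta \<Rightarrow> Theta | Eps i \<Rightarrow> Eps (\<sigma> i))"

lift_definition phi :: "(nat \<Rightarrow> nat) \<Rightarrow> 'c::{comm_ring, comm_monoid_mult} ceps \<Rightarrow> 'c ceps"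
  is "\<lambda>\<sigma>. push (push (ren \<sigma>))"
proof -
  fix \<sigma> :: "nat \<Rightarrow> nat" and p q :: "'c cpoly"
  let ?f = "push (push (ren \<sigma>)) :: 'c cpoly \<Rightarrow> 'c cpoly"
  have mult: "?f (a * b) = ?f a * ?f b" for a b
    by (rule push_mult) (rule push_add)
  have "?f r \<in> ideal_gen ceps_rels" if "r \<in> ideal_gen ceps_rels" for r
    using that
  proof induction
    case (ideal_gen_base r)
    then have "?f r \<in> ceps_rels"
      unfolding ceps_rels_def by (auto simp: push_diff mult ren_def)
    then show ?case by (rule ideal_gen.ideal_gen_base)
  qed (auto simp: push_diff mult intro: ideal_gen.intros)
  moreover assume "p - q \<in> ideal_gen ceps_rels"
  ultimately show "?f p - ?f q \<in> ideal_gen ceps_rels"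
    by (simp flip: push_diff)
qed

lemma phi_hom:
  "phi \<sigma> (a + b) = phi \<sigma> a + phi \<sigma> b" "phi \<sigma> (a * b) = phi \<sigma> a * phi \<sigma> b"
  "phi \<sigma> (ceps_of c) = ceps_of c" "phi \<sigma> theta = theta" "phi \<sigma> (eps i) = eps (\<sigma> i)"
  by (transfer; simp add: push_add push_mult ren_def ideal_gen_zero)+

subsection \<open>Free algebras and the generalized Grassmann algebra\<close>

datatype word = Word (letters: "nat list")

instantiation word :: monoid_add
begin

definition zero_word :: word where "0 = Word []"
definition plus_word :: "word \<Rightarrow> word \<Rightarrow> word" where "v + w = Word (letters v @ letters w)"

instance
  by standard (simp_all add: zero_word_def plus_word_def)

end

text \<open>The monoid is written additively because the convolution product of
  \<open>poly_mapping\<close> refers to \<open>(+)\<close> on exponents; it is not commutative.\<close>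

type_synonym 'r free_alg = "word \<Rightarrow>\<^sub>0 'r"

abbreviation Xvar :: "nat \<Rightarrow> 'r::{comm_ring, comm_monoid_mult} free_alg"
  where "Xvar i \<equiv> Poly_Mapping.single (Word [i]) 1"

definition galg_rels :: "'c::{comm_ring, comm_monoid_mult} ceps free_alg set"
  where "galg_rels = {Xvar i * Xvar j - Xvar j * Xvar i
    - Poly_Mapping.single 0 (eps i * eps j) * Xvar i * Xvar j | i j. True}"

quotient_type (overloaded) 'c galg = "'c::{comm_ring, comm_monoid_mult} ceps free_alg"
  / "\<lambda>p q. p - q \<in> ideal_gen galg_rels"
  by (rule ideal_gen_equivp)

instantiation galg :: ("{comm_ring, comm_monoid_mult}") "{ring, monoid_mult}"
begin

lift_definition zero_galg :: "'a galg" is "0" .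
lift_definition one_galg :: "'a galg" is "Poly_Mapping.single 0 1" .
lift_definition plus_galg :: "'a galg \<Rightarrow> 'a galg \<Rightarrow> 'a galg" is "(+)"
  by (rule ideal_gen_cong_add)
lift_definition minus_galg :: "'a galg \<Rightarrow> 'a galg \<Rightarrow> 'a galg" is "(-)"
  by (rule ideal_gen_cong_diff)
lift_definition uminus_galg :: "'a galg \<Rightarrow> 'a galg" is "uminus"
  by (rule ideal_gen_cong_uminus)
lift_definition times_galg :: "'a galg \<Rightarrow> 'a galg \<Rightarrow> 'a galg" is "(*)"
  by (rule ideal_gen_cong_mult)

instance
  by standard (transfer; simp add: algebra_simps ideal_gen_zero)+

end

definition galg_of :: "'c::{comm_ring, comm_monoid_mult} ceps \<Rightarrow> 'c galg"
  where "galg_of a = abs_galg (Poly_Mapping.single 0 a)"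

definition gen_e :: "nat \<Rightarrow> 'c::{comm_ring, comm_monoid_mult} galg"
  where "gen_e i = abs_galg (Xvar i)"

lemma ceps_relations:
  "theta * theta = (1 + 1 :: 'c::{comm_ring, comm_monoid_mult} ceps)"
  "eps i * eps i = (theta * eps i :: 'c ceps)"
proof -
  show "theta * theta = (1 + 1 :: 'c ceps)"
  proof transfer
    have eq: "Poly_Mapping.single 0 1 + Poly_Mapping.single 0 1
        = (Poly_Mapping.single 0 (1 + 1) :: 'c cpoly)"
      by (simp add: single_add)
    show "Cvar Theta * Cvar Theta
        - (Poly_Mapping.single 0 1 + Poly_Mapping.single 0 1 :: 'c cpoly) \<in> ideal_gen ceps_rels"
      unfolding eq by (rule ideal_gen_base) (simp add: ceps_rels_def)
  qed
  show "eps i * eps i = (theta * eps i :: 'c ceps)"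
    by transfer (rule ideal_gen_base, unfold ceps_rels_def, blast)
qed

lemma galg_relations:
  "galg_of a * x = x * galg_of a"
  "gen_e i * gen_e j - gen_e j * gen_e i = galg_of (eps i * eps j) * gen_e i * gen_e j"
proof -
  have "Poly_Mapping.single 0 a * p = p * Poly_Mapping.single 0 a" for p :: "'a ceps free_alg"
    by (induction p rule: pm_induct) (simp_all add: mult_single distrib_left distrib_right mult.commute)
  moreover obtain p where "x = abs_galg p"
    by (induction x rule: galg.abs_induct) blast
  ultimately show "galg_of a * x = x * galg_of a"
    by (simp add: galg_of_def times_galg.abs_eq)
  show "gen_e i * gen_e j - gen_e j * gen_e i = galg_of (eps i * eps j) * gen_e i * gen_e j"
    unfolding gen_e_def galg_of_def times_galg.abs_eq minus_galg.abs_eq galg.abs_eq_iff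
    by (rule ideal_gen_base) (auto simp: galg_rels_def)
qed

definition galg_scale :: "'c::{comm_ring, comm_monoid_mult} \<Rightarrow> 'c galg \<Rightarrow> 'c galg"
  where "galg_scale c a = galg_of (ceps_of c) * a"

subsection \<open>Polynomial identities\<close>

text \<open>A \<open>C\<close>-algebra is given by its ring type \<open>'a\<close> and its scalar multiplication \<open>sc\<close>.\<close>

definition free_eval :: "('c \<Rightarrow> 'a \<Rightarrow> 'a) \<Rightarrow> (nat \<Rightarrow> 'a)
    \<Rightarrow> 'c::{comm_ring, comm_monoid_mult} free_alg \<Rightarrow> 'a::{ring, monoid_mult}"
  where "free_eval sc s f =
    (\<Sum>w\<in>Poly_Mapping.keys f. sc (Poly_Mapping.lookup f w) (prod_list (map s (letters w))))"

definition poly_ids :: "('c \<Rightarrow> 'a \<Rightarrow> 'a::{ring, monoid_mult})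
    \<Rightarrow> 'c::{comm_ring, comm_monoid_mult} free_alg set"
  where "poly_ids sc = {f. \<forall>s. free_eval sc s f = 0}"

subsection \<open>Modules over the group algebra of the symmetric group\<close>

text \<open>A module over \<open>C[S\<^sub>n]\<close> is given by its \<open>C\<close>-module structure and the \<open>C\<close>-linear action
  of the permutations of \<open>{..<n}\<close>. Only the values of \<open>mact\<close> at such permutations matter.\<close>

record ('c, 'm) sn_module =
  mcarrier :: "'m set"
  mzero :: 'm
  madd :: "'m \<Rightarrow> 'm \<Rightarrow> 'm"
  mscale :: "'c \<Rightarrow> 'm \<Rightarrow> 'm"
  mact :: "(nat \<Rightarrow> nat) \<Rightarrow> 'm \<Rightarrow> 'm"

definition sn_submodule :: "nat \<Rightarrow> 'm set \<Rightarrow> ('c, 'm) sn_module \<Rightarrow> bool"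
  where "sn_submodule n N M \<longleftrightarrow> N \<subseteq> mcarrier M \<and> mzero M \<in> N
    \<and> (\<forall>a\<in>N. \<forall>b\<in>N. madd M a b \<in> N)
    \<and> (\<forall>c. \<forall>a\<in>N. mscale M c a \<in> N)
    \<and> (\<forall>\<sigma>. \<sigma> permutes {..<n} \<longrightarrow> (\<forall>a\<in>N. mact M \<sigma> a \<in> N))"

definition sn_generated :: "nat \<Rightarrow> ('c, 'm) sn_module \<Rightarrow> 'm set \<Rightarrow> ('c, 'm) sn_module"
  where "sn_generated n M S = M\<lparr>mcarrier := \<Inter>{N. sn_submodule n N M \<and> S \<subseteq> N}\<rparr>"

definition mcoset :: "('c, 'm) sn_module \<Rightarrow> 'm set \<Rightarrow> 'm \<Rightarrow> 'm set"
  where "mcoset M N a = {madd M a k | k. k \<in> N}"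

text \<open>The unions over representatives are the usual well-defined operations on cosets whenever
  \<open>N\<close> is a submodule: all the cosets in such a union then coincide.\<close>

definition sn_quotient :: "('c, 'm) sn_module \<Rightarrow> 'm set \<Rightarrow> ('c, 'm set) sn_module"
  where "sn_quotient M N = \<lparr>
    mcarrier = mcoset M N ` mcarrier M,
    mzero = mcoset M N (mzero M),
    madd = (\<lambda>A B. \<Union>a\<in>A. \<Union>b\<in>B. mcoset M N (madd M a b)),
    mscale = (\<lambda>c A. \<Union>a\<in>A. mcoset M N (mscale M c a)),
    mact = (\<lambda>\<sigma> A. \<Union>a\<in>A. mcoset M N (mact M \<sigma> a))\<rparr>"

definition sn_isomorphic :: "nat \<Rightarrow> ('c, 'm) sn_module \<Rightarrow> ('c, 'k) sn_module \<Rightarrow> bool"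
  where "sn_isomorphic n M N \<longleftrightarrow> (\<exists>f. bij_betw f (mcarrier M) (mcarrier N)
    \<and> (\<forall>a\<in>mcarrier M. \<forall>b\<in>mcarrier M. f (madd M a b) = madd N (f a) (f b))
    \<and> (\<forall>c. \<forall>a\<in>mcarrier M. f (mscale M c a) = mscale N c (f a))
    \<and> (\<forall>\<sigma>. \<sigma> permutes {..<n} \<longrightarrow>
        (\<forall>a\<in>mcarrier M. f (mact M \<sigma> a) = mact N \<sigma> (f a))))"

subsection \<open>Multilinear polynomials and generalized signs\<close>

definition multilinear :: "nat \<Rightarrow> ('c::{comm_ring, comm_monoid_mult}, 'c free_alg) sn_module"
  where "multilinear n = \<lparr>
    mcarrier = {\<Sum>\<sigma> | \<sigma> permutes {..<n}. Poly_Mapping.single (Word (map \<sigma> [0..<n])) (\<alpha> \<sigma>) | \<alpha>. True},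
    mzero = 0,
    madd = (+),
    mscale = (\<lambda>c f. Poly_Mapping.single 0 c * f),
    mact = (\<lambda>\<tau>. push (\<lambda>w. Word (map \<tau> (letters w))))\<rparr>"

definition comodule :: "nat \<Rightarrow> ('c::{comm_ring, comm_monoid_mult} \<Rightarrow> 'a \<Rightarrow> 'a::{ring, monoid_mult})
    \<Rightarrow> ('c, 'c free_alg set) sn_module"
  where "comodule n sc =
    sn_quotient (multilinear n) (poly_ids sc \<inter> mcarrier (multilinear n))"

definition gen_sgn :: "nat \<Rightarrow> (nat \<Rightarrow> nat) \<Rightarrow> 'c::{comm_ring, comm_monoid_mult} ceps"
  where "gen_sgn n \<sigma> =
    (\<Prod>(i, j) | i < j \<and> j < n \<and> \<sigma> i > \<sigma> j. 1 - eps (\<sigma> i) * eps (\<sigma> j))"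

definition ceps_module :: "nat \<Rightarrow> ('c::{comm_ring, comm_monoid_mult}, 'c ceps) sn_module"
  where "ceps_module n = \<lparr>
    mcarrier = UNIV,
    mzero = 0,
    madd = (+),
    mscale = (\<lambda>c a. ceps_of c * a),
    mact = (\<lambda>\<sigma> a. gen_sgn n \<sigma> * phi \<sigma> a)\<rparr>"

definition gen_signs :: "nat \<Rightarrow> ('c::{comm_ring, comm_monoid_mult}, 'c ceps) sn_module"
  where "gen_signs n = sn_generated n (ceps_module n) {1}"

end

theory Submission
  imports Defs
begin

text \<open>
  Write \<open>e\<^sub>i\<close> for \<open>gen_e i\<close> and \<open>\<epsilon>\<^sub>i\<close> for \<open>eps i\<close>. The defining relation says
  \<open>e\<^sub>i e\<^sub>j = (1 - \<epsilon>\<^sub>i \<epsilon>\<^sub>j) e\<^sub>j e\<^sub>i\<close>, so sorting the product \<open>e\<^bsub>\<sigma> 0\<^esub> \<dots> e\<^bsub>\<sigma> (n - 1)\<^esub>\<close> costs one factor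
  per inversion and yields \<open>gen_sgn n \<sigma> \<cdot> e\<^sub>0 \<dots> e\<^bsub>n - 1\<^esub>\<close>. This suggests the \<open>C\<close>-linear map
  \<open>sgn_map\<close>, which sends the multilinear monomial of \<open>\<sigma>\<close> to \<open>gen_sgn n \<sigma>\<close>. The theorem is the first
  isomorphism theorem for this map, once three things are known.

  \<^item> Its kernel on multilinear polynomials consists of the identities (\<open>ml_poly_in_poly_ids_iff\<close>).
    Evaluating an identity at the generators gives its image times \<open>e\<^sub>0 \<dots> e\<^bsub>n - 1\<^esub>\<close>, and this product
    has no nonzero annihilator in \<open>C[\<epsilon>]\<close> (\<open>multilinear_coeff_unique\<close>). Conversely, by multilinearity it
    suffices to substitute monomials \<open>m\<^sub>i\<close> with coefficients in \<open>C[\<epsilon>]\<close>. Monomials commute by the same law as the generators,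
    \<open>m\<^sub>i m\<^sub>j = (1 - \<eta>\<^sub>i \<eta>\<^sub>j) m\<^sub>j m\<^sub>i\<close>, for suitable \<open>\<eta>\<^sub>i\<close> with \<open>\<eta>\<^sub>i\<^sup>2 = \<theta> \<eta>\<^sub>i\<close>
    (\<open>monomials_sgn_commuting\<close>). The equations for \<open>\<eta>\<^sub>i\<close> make \<open>\<epsilon>\<^sub>i \<mapsto> \<eta>\<^sub>i\<close> an endomorphism of
    \<open>C[\<epsilon>]\<close>, and the value of the polynomial is the image of its \<open>sgn_map\<close> under this endomorphism,
    times \<open>m\<^sub>0 \<dots> m\<^bsub>n - 1\<^esub>\<close>.

  \<^item> It is equivariant, which is the cocycle identity for generalized signs (\<open>gen_sgn_comp\<close>). That
    identity follows by sorting one product of generators in two ways and comparing coefficients.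

  \<^item> Its image is the submodule generated by \<open>1\<close>, because \<open>gen_sgn n \<sigma>\<close> is the result of letting
    \<open>\<sigma>\<close> act on \<open>1\<close> (\<open>sgn_map_image\<close>).
\<close>

section \<open>Linear extension\<close>

definition linext :: "('a \<Rightarrow> 'r \<Rightarrow> 'b) \<Rightarrow> ('a \<Rightarrow>\<^sub>0 'r::comm_monoid_add) \<Rightarrow> 'b::comm_monoid_add"
  where "linext g p = (\<Sum>k\<in>Poly_Mapping.keys p. g k (Poly_Mapping.lookup p k))"

lemma linext_0 [simp]: "linext g 0 = 0"
  by (simp add: linext_def)

lemma linext_single:
  assumes "\<And>k. g k 0 = 0"
  shows "linext g (Poly_Mapping.single k c) = g k c"
  by (cases "c = 0") (simp_all add: linext_def assms)

lemma linext_add: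
  assumes zero: "\<And>k. g k 0 = 0" and add: "\<And>k a b. g k (a + b) = g k a + g k b"
  shows "linext g (p + q) = linext g p + linext g q"
proof -
  let ?A = "Poly_Mapping.keys p \<union> Poly_Mapping.keys q"
  have superset: "linext g r = (\<Sum>k\<in>?A. g k (Poly_Mapping.lookup r k))"
    if "Poly_Mapping.keys r \<subseteq> ?A" for r
    unfolding linext_def
    by (rule sum.mono_neutral_left) (use that zero in \<open>auto simp: in_keys_iff\<close>)
  show ?thesis
    by (simp add: superset keys_add lookup_add add sum.distrib)
qed

section \<open>Substitutions in the coefficient ring\<close>

lemma ceps_of_hom:
  "ceps_of 0 = 0" "ceps_of 1 = 1"
  "ceps_of (a + b) = ceps_of a + ceps_of b" "ceps_of (a * b) = ceps_of a * ceps_of b"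
  by (transfer; simp add: single_add mult_single ideal_gen_zero)+

definition meval :: "(cvar \<Rightarrow> 'r) \<Rightarrow> (cvar \<Rightarrow>\<^sub>0 nat) \<Rightarrow> 'r::comm_monoid_mult"
  where "meval f m = (\<Prod>v\<in>Poly_Mapping.keys m. f v ^ Poly_Mapping.lookup m v)"

lemma meval_zero [simp]: "meval f 0 = 1"
  by (simp add: meval_def)

lemma meval_var [simp]: "meval f (Poly_Mapping.single v (Suc 0)) = f v"
  by (simp add: meval_def)

lemma meval_add: "meval f (m + m') = meval f m * meval f m'"
proof -
  let ?A = "Poly_Mapping.keys m \<union> Poly_Mapping.keys m'"
  have superset: "meval f r = (\<Prod>v\<in>?A. f v ^ Poly_Mapping.lookup r v)"
    if "Poly_Mapping.keys r \<subseteq> ?A" for r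
    unfolding meval_def
    by (rule prod.mono_neutral_left) (use that in \<open>auto simp: in_keys_iff\<close>)
  show ?thesis
    by (simp add: superset keys_add lookup_add power_add prod.distrib)
qed

definition peval :: "(cvar \<Rightarrow> 'c ceps) \<Rightarrow> 'c cpoly \<Rightarrow> 'c::{comm_ring, comm_monoid_mult} ceps"
  where "peval f = linext (\<lambda>m c. ceps_of c * meval f m)"

lemma peval_add: "peval f (p + q) = peval f p + peval f q"
  unfolding peval_def by (rule linext_add) (simp_all add: ceps_of_hom distrib_right)

lemma peval_single: "peval f (Poly_Mapping.single m c) = ceps_of c * meval f m"
  unfolding peval_def by (rule linext_single) (simp add: ceps_of_hom)

lemma peval_zero [simp]: "peval f 0 = 0"
  by (simp add: peval_def)

lemma peval_diff: "peval f (p - q) = peval f p - peval f q"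
  by (metis add_diff_cancel diff_add_cancel peval_add)

lemma peval_mult: "peval f (p * q) = peval f p * peval f q"
proof (induction p rule: pm_induct)
  case (single k c)
  show ?case
    by (induction q rule: pm_induct)
      (simp_all add: mult_single peval_single peval_add ceps_of_hom meval_add distrib_left distrib_right
        ac_simps)
qed (simp_all add: distrib_right peval_add)

definition subst_var :: "(nat \<Rightarrow> 'c ceps) \<Rightarrow> cvar \<Rightarrow> 'c::{comm_ring, comm_monoid_mult} ceps"
  where "subst_var \<eta> v = (case v of Theta \<Rightarrow> theta | Eps i \<Rightarrow> \<eta> i)"

text \<open>
  The endomorphism of \<open>C[\<epsilon>]\<close> with \<open>\<epsilon>\<^sub>i \<mapsto> \<eta>\<^sub>i\<close> exists only when every \<open>\<eta>\<^sub>i\<close> satisfies the relation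
  that is imposed on \<open>\<epsilon>\<^sub>i\<close>. Evaluating a chosen representative gives a function for every \<open>\<eta>\<close>; under
  that condition the choice does not matter.
\<close>

definition ceps_subst :: "(nat \<Rightarrow> 'c ceps) \<Rightarrow> 'c ceps \<Rightarrow> 'c::{comm_ring, comm_monoid_mult} ceps"
  where "ceps_subst \<eta> a = peval (subst_var \<eta>) (rep_ceps a)"

lemma ceps_subst_abs:
  assumes \<eta>: "\<And>i. \<eta> i * \<eta> i = theta * \<eta> i"
  shows "ceps_subst \<eta> (abs_ceps p) = peval (subst_var \<eta>) p"
proof -
  have kill: "peval (subst_var \<eta>) r = 0" if "r \<in> ideal_gen ceps_rels" for r
    using that
  proof induction
    case (ideal_gen_base r)
    have var: "peval (subst_var \<eta>) (Cvar v) = subst_var \<eta> v" for v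
      by (simp add: peval_single ceps_of_hom)
    from ideal_gen_base consider
        "r = Cvar Theta * Cvar Theta - Poly_Mapping.single 0 (1 + 1)"
      | i where "r = Cvar (Eps i) * Cvar (Eps i) - Cvar Theta * Cvar (Eps i)"
      by (auto simp: ceps_rels_def)
    then show ?case
    proof cases
      case 1
      show ?thesis
        unfolding 1 peval_diff peval_mult var
        by (simp add: peval_single ceps_of_hom subst_var_def ceps_relations)
    next
      case (2 i)
      show ?thesis
        unfolding 2 peval_diff peval_mult var by (simp add: subst_var_def \<eta>)
    qed
  qed (simp_all add: peval_diff peval_mult)
  have "rep_ceps (abs_ceps p) - p \<in> ideal_gen ceps_rels"
    using Quotient3_abs_rep[OF Quotient3_ceps, of "abs_ceps p"] by (simp add: ceps.abs_eq_iff)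
  from kill[OF this] show ?thesis
    by (simp add: ceps_subst_def peval_diff)
qed

lemma ceps_subst_hom:
  assumes \<eta>: "\<And>i. \<eta> i * \<eta> i = theta * \<eta> i"
  shows "ceps_subst \<eta> (a + b) = ceps_subst \<eta> a + ceps_subst \<eta> b"
    "ceps_subst \<eta> (a - b) = ceps_subst \<eta> a - ceps_subst \<eta> b"
    "ceps_subst \<eta> (a * b) = ceps_subst \<eta> a * ceps_subst \<eta> b"
    "ceps_subst \<eta> (ceps_of c) = ceps_of c"
    "ceps_subst \<eta> (eps i) = \<eta> i"
    "ceps_subst \<eta> 0 = 0" "ceps_subst \<eta> 1 = 1"
proof -
  note abs = ceps_subst_abs[OF \<eta>]
  show "ceps_subst \<eta> (a + b) = ceps_subst \<eta> a + ceps_subst \<eta> b"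
    by (induction a rule: ceps.abs_induct, induction b rule: ceps.abs_induct)
      (simp add: abs plus_ceps.abs_eq peval_add)
  show "ceps_subst \<eta> (a - b) = ceps_subst \<eta> a - ceps_subst \<eta> b"
    by (induction a rule: ceps.abs_induct, induction b rule: ceps.abs_induct)
      (simp add: abs minus_ceps.abs_eq peval_diff)
  show "ceps_subst \<eta> (a * b) = ceps_subst \<eta> a * ceps_subst \<eta> b"
    by (induction a rule: ceps.abs_induct, induction b rule: ceps.abs_induct)
      (simp add: abs times_ceps.abs_eq peval_mult)
  show of: "ceps_subst \<eta> (ceps_of c) = ceps_of c" for c
    by (simp add: ceps_of.abs_eq[of c] abs peval_single)
  show "ceps_subst \<eta> (eps i) = \<eta> i"
    by (simp add: eps.abs_eq abs peval_single subst_var_def ceps_of_hom)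
  show "ceps_subst \<eta> 0 = 0" "ceps_subst \<eta> 1 = 1"
    using of[of 0] of[of 1] by (simp_all add: ceps_of_hom)
qed

section \<open>Signs of lists\<close>

text \<open>
  Signs are taken with respect to an arbitrary family \<open>\<eta>\<close>, since substituting monomials for
  the variables replaces \<open>\<epsilon>\<^sub>i\<close> by other elements. The recursion follows insertion sort: moving
  \<open>x\<close> to its place in the sorted rest passes exactly the smaller letters.
\<close>

fun list_sgn :: "(nat \<Rightarrow> 'r) \<Rightarrow> nat list \<Rightarrow> 'r::{comm_ring, comm_monoid_mult}"
  where
    "list_sgn \<eta> [] = 1"
  | "list_sgn \<eta> (x # xs) = (\<Prod>y\<leftarrow>filter (\<lambda>y. y < x) xs. 1 - \<eta> x * \<eta> y) * list_sgn \<eta> xs"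

lemma list_sgn_snoc:
  "list_sgn \<eta> (xs @ [y]) = list_sgn \<eta> xs * (\<Prod>x\<leftarrow>filter (\<lambda>x. y < x) xs. 1 - \<eta> x * \<eta> y)"
  by (induction xs) (auto simp: ac_simps)

lemma list_sgn_map:
  "list_sgn \<eta> (map f [0..<n])
    = (\<Prod>(i, j) | i < j \<and> j < n \<and> f i > f j. 1 - \<eta> (f i) * \<eta> (f j))"
proof (induction n)
  case (Suc n)
  let ?g = "\<lambda>(i, j). 1 - \<eta> (f i) * \<eta> (f j)"
  let ?I = "\<lambda>n. {(i, j). i < j \<and> j < n \<and> f i > f j}"
  let ?J = "{i. i < n \<and> f n < f i}"
  have fin: "finite (?I n)"
    by (rule finite_subset[of _ "{..<n} \<times> {..<n}"]) auto
  have "?I (Suc n) = ?I n \<union> (\<lambda>i. (i, n)) ` ?J"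
    by (auto simp: less_Suc_eq)
  then have "prod ?g (?I (Suc n)) = prod ?g (?I n \<union> (\<lambda>i. (i, n)) ` ?J)"
    by simp
  also have "\<dots> = prod ?g (?I n) * prod ?g ((\<lambda>i. (i, n)) ` ?J)"
    by (rule prod.union_disjoint) (use fin in auto)
  also have "prod ?g ((\<lambda>i. (i, n)) ` ?J) = (\<Prod>i\<in>?J. 1 - \<eta> (f i) * \<eta> (f n))"
    by (subst prod.reindex) (auto simp: inj_on_def)
  also have "?J = set (filter (\<lambda>i. f n < f i) [0..<n])"
    by auto
  also have "(\<Prod>i\<in>\<dots>. 1 - \<eta> (f i) * \<eta> (f n))
      = (\<Prod>i\<leftarrow>filter (\<lambda>i. f n < f i) [0..<n]. 1 - \<eta> (f i) * \<eta> (f n))"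
    by (rule prod.distinct_set_conv_list) simp
  also have "\<dots> = (\<Prod>x\<leftarrow>filter (\<lambda>x. f n < x) (map f [0..<n]). 1 - \<eta> x * \<eta> (f n))"
    by (simp add: filter_map o_def)
  finally show ?case
    using Suc.IH by (simp add: list_sgn_snoc)
qed simp

lemma gen_sgn_list: "gen_sgn n \<sigma> = list_sgn eps (map \<sigma> [0..<n])"
  unfolding gen_sgn_def list_sgn_map by simp

lemma list_sgn_sorted: "sorted xs \<Longrightarrow> list_sgn \<eta> xs = 1"
proof (induction xs)
  case (Cons x xs)
  then have "filter (\<lambda>y. y < x) xs = []"
    by (auto simp: filter_empty_conv)
  with Cons show ?case by simp
qed simp

lemma list_sgn_hom:
  assumes one: "h 1 = 1" and diff: "\<And>a b. h (a - b) = h a - h b"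
    and mult: "\<And>a b. h (a * b) = h a * h b"
  shows "h (list_sgn \<eta> xs) = list_sgn (\<lambda>i. h (\<eta> i)) xs"
proof (induction xs)
  case (Cons x xs)
  have "h (\<Prod>y\<leftarrow>ys. 1 - \<eta> x * \<eta> y) = (\<Prod>y\<leftarrow>ys. 1 - h (\<eta> x) * h (\<eta> y))" for ys
    by (induction ys) (simp_all add: one diff mult)
  with Cons show ?case by (simp add: mult)
qed (simp add: one)

lemma phi_zero_one_diff:
  "phi \<sigma> 0 = 0" "phi \<sigma> 1 = 1" "phi \<sigma> (a - b) = phi \<sigma> a - phi \<sigma> b"
proof -
  show "phi \<sigma> 0 = 0" "phi \<sigma> 1 = 1"
    using phi_hom(3)[of \<sigma> 0] phi_hom(3)[of \<sigma> 1] by (simp_all add: ceps_of_hom)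
  show "phi \<sigma> (a - b) = phi \<sigma> a - phi \<sigma> b"
    using phi_hom(1)[of \<sigma> "a - b" b] by simp
qed

lemma phi_list_sgn: "phi \<sigma> (list_sgn eps xs) = list_sgn (\<lambda>i. eps (\<sigma> i)) xs"
  by (subst list_sgn_hom[where h = "phi \<sigma>"]) (simp_all add: phi_zero_one_diff phi_hom)

text \<open>
  Exchanging two letters twice must give back the original word, so the sign factors have to
  be involutions. Here \<open>(ab)\<^sup>2 = \<theta>\<^sup>2 ab\<close>, and \<open>\<theta>\<^sup>2 = 2\<close> makes this cancel against \<open>- 2ab\<close>.
\<close>

lemma sign_factor_square:
  fixes a b t :: "'r::{comm_ring, comm_monoid_mult}"
  assumes "t * t = 1 + 1" "a * a = t * a" "b * b = t * b"
  shows "(1 - a * b) * (1 - a * b) = 1"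
proof -
  have "(a * b) * (a * b) = (a * a) * (b * b)" by (simp only: ac_simps)
  also have "\<dots> = (t * t) * (a * b)" unfolding assms(2,3) by (simp only: ac_simps)
  also have "\<dots> = a * b + a * b" unfolding assms(1) by (simp add: distrib_right)
  finally show ?thesis by (simp add: left_diff_distrib right_diff_distrib)
qed

text \<open>
  Exactly one of the two words has the inversion between \<open>i\<close> and \<open>j\<close>. If it is the one on the
  right, the factor appears twice there and squares to \<open>1\<close>.
\<close>

lemma list_sgn_swap:
  assumes "i \<noteq> j" "\<And>i. \<eta> i * \<eta> i = t * \<eta> i" "t * t = 1 + 1"
  shows "list_sgn \<eta> (u @ j # i # v) = (1 - \<eta> i * \<eta> j) * list_sgn \<eta> (u @ i # j # v)"
proof (induction u)
  case Nil
  show ?case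
  proof (cases "i < j")
    case True
    then show ?thesis by (simp add: ac_simps)
  next
    case False
    let ?c = "1 - \<eta> i * \<eta> j"
    have c: "?c * (?c * x) = x" for x
      using sign_factor_square[of t "\<eta> i" "\<eta> j"] assms by (simp flip: mult.assoc)
    have "list_sgn \<eta> ([] @ i # j # v) = ?c * list_sgn \<eta> ([] @ j # i # v)"
      using False assms(1) by (simp add: ac_simps)
    then show ?thesis by (simp only: c)
  qed
next
  case (Cons x u)
  then show ?case by (simp add: ac_simps)
qed

section \<open>Reordering products in the generalized Grassmann algebra\<close>

lemma galg_of_hom:
  "galg_of 0 = 0" "galg_of 1 = 1" "galg_of (a + b) = galg_of a + galg_of b"
  "galg_of (a - b) = galg_of a - galg_of b" "galg_of (a * b) = galg_of a * galg_of b"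
  by (simp_all add: galg_of_def zero_galg_def one_galg_def plus_galg.abs_eq minus_galg.abs_eq
      times_galg.abs_eq single_add single_diff mult_single)

text \<open>
  As a rewrite rule this loops on two adjacent scalars, so \<open>x\<close> is instantiated at every use.
\<close>

lemma galg_of_left_commute: "x * (galg_of a * y) = galg_of a * (x * y)"
  by (metis galg_relations(1) mult.assoc)

lemma galg_of_merge: "galg_of a * (galg_of b * x) = galg_of (a * b) * x"
  by (simp add: galg_of_hom mult.assoc)

text \<open>
  The abstract form of the commutation law of the generators. Sorting only needs this law, so
  it applies equally to renamed generators and to monomials. For
  \<open>i = j\<close> it says that \<open>\<eta>\<^sub>i\<^sup>2\<close> annihilates \<open>s\<^sub>i\<^sup>2\<close>; overlapping words require this case.
\<close>

definition sgn_commuting :: "(nat \<Rightarrow> 'c galg) \<Rightarrow> (nat \<Rightarrow> 'c::{comm_ring, comm_monoid_mult} ceps) \<Rightarrow> bool"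
  where "sgn_commuting s \<eta> \<longleftrightarrow> (\<forall>i j. s i * s j = galg_of (1 - \<eta> i * \<eta> j) * (s j * s i))"

lemma prod_insort:
  assumes "sgn_commuting s \<eta>" "sorted ys"
  shows "prod_list (map s (x # ys))
    = galg_of (\<Prod>y\<leftarrow>filter (\<lambda>y. y < x) ys. 1 - \<eta> x * \<eta> y) * prod_list (map s (insort x ys))"
  using assms(2)
proof (induction ys)
  case (Cons y ys)
  show ?case
  proof (cases "x \<le> y")
    case True
    \<comment> \<open>Here \<open>x\<close> stays in front, and since the list is sorted nothing in it is smaller.\<close>
    with Cons.prems have "filter (\<lambda>y. y < x) (y # ys) = []"
      by (force simp: filter_empty_conv)
    with True show ?thesis by (simp add: galg_of_hom)
  next
    case False
    let ?c = "\<Prod>z\<leftarrow>filter (\<lambda>z. z < x) ys. 1 - \<eta> x * \<eta> z"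
    \<comment> \<open>The letter \<open>x\<close> moves past the smaller letter \<open>y\<close>.\<close>
    have xy: "s x * s y = galg_of (1 - \<eta> x * \<eta> y) * (s y * s x)"
      using assms(1) unfolding sgn_commuting_def by blast
    have "prod_list (map s (x # y # ys)) = s x * s y * prod_list (map s ys)"
      by (simp add: mult.assoc)
    also have "\<dots> = galg_of (1 - \<eta> x * \<eta> y) * (s y * prod_list (map s (x # ys)))"
      unfolding xy by (simp add: mult.assoc)
    also have "\<dots> = galg_of ((1 - \<eta> x * \<eta> y) * ?c) * (s y * prod_list (map s (insort x ys)))"
      using Cons by (simp add: galg_of_left_commute[of "s y"] galg_of_merge)
    finally show ?thesis
      using False by simp
  qed
qed (simp add: galg_of_hom)

lemma prod_sort:
  assumes "sgn_commuting s \<eta>"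
  shows "prod_list (map s xs) = galg_of (list_sgn \<eta> xs) * prod_list (map s (sort xs))"
proof (induction xs)
  case (Cons x xs)
  let ?c = "\<lambda>ys. \<Prod>y\<leftarrow>filter (\<lambda>y. y < x) ys. 1 - \<eta> x * \<eta> y"
  have c: "?c (sort xs) = ?c xs"
    unfolding prod_mset_prod_list[symmetric] mset_map mset_filter mset_sort ..
  have "prod_list (map s (x # xs)) = galg_of (list_sgn \<eta> xs) * prod_list (map s (x # sort xs))"
    by (simp add: Cons.IH galg_of_left_commute[of "s x"])
  also have "\<dots> = galg_of (list_sgn \<eta> xs) * (galg_of (?c xs) * prod_list (map s (sort (x # xs))))"
    by (subst prod_insort[OF assms]) (simp_all add: c)
  finally show ?case by (simp add: galg_of_merge mult.commute)
qed (simp add: galg_of_hom)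

lemma sort_permutes:
  assumes "\<sigma> permutes {..<n}"
  shows "sort (map \<sigma> [0..<n]) = [0..<n]"
proof (rule sorted_distinct_set_unique)
  show "distinct (sort (map \<sigma> [0..<n]))"
    using permutes_inj_on[OF assms] by (simp add: distinct_map)
  show "set (sort (map \<sigma> [0..<n])) = set [0..<n]"
    using permutes_image[OF assms] by (simp add: atLeast0LessThan)
qed simp_all

lemma prod_permuted:
  assumes "sgn_commuting s \<eta>" "\<sigma> permutes {..<n}"
  shows "prod_list (map s (map \<sigma> [0..<n]))
    = galg_of (list_sgn \<eta> (map \<sigma> [0..<n])) * prod_list (map s [0..<n])"
  using prod_sort[OF assms(1), of "map \<sigma> [0..<n]"] sort_permutes[OF assms(2)] by simp

lemma gen_e_commute: "gen_e i * gen_e j = galg_of (1 - eps i * eps j) * (gen_e j * gen_e i)"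
proof -
  have "gen_e i * gen_e j = gen_e j * gen_e i - (gen_e j * gen_e i - gen_e i * gen_e j)"
    by simp
  also have "\<dots> = gen_e j * gen_e i - galg_of (eps i * eps j) * (gen_e j * gen_e i)"
    unfolding galg_relations(2) by (simp only: mult.assoc mult.commute[of "eps j"])
  finally show ?thesis
    by (simp add: galg_of_hom left_diff_distrib)
qed

lemma sgn_commuting_gen_e: "sgn_commuting (\<lambda>i. gen_e (\<tau> i)) (\<lambda>i. eps (\<tau> i))"
  unfolding sgn_commuting_def by (simp flip: gen_e_commute)

section \<open>Freeness of the multilinear component\<close>

lemma abs_galg_single:
  "abs_galg (Poly_Mapping.single (Word w) a) = galg_of a * prod_list (map gen_e w)"
proof (induction w)
  case Nil
  show ?case by (simp add: galg_of_def zero_word_def)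
next
  case (Cons x w)
  have "Poly_Mapping.single (Word (x # w)) a = Xvar x * Poly_Mapping.single (Word w) a"
    by (simp add: mult_single plus_word_def)
  then show ?case
    by (simp add: Cons.IH galg_of_left_commute[of "gen_e x"] flip: times_galg.abs_eq gen_e_def)
qed

text \<open>
  The coefficient functional: it reads off the coefficient of \<open>e\<^sub>0 \<dots> e\<^bsub>n - 1\<^esub>\<close> after sorting, and
  ignores all words that are not rearrangements of \<open>0, \<dots>, n - 1\<close>. It takes values in \<open>C[\<epsilon>]\<close> and vanishes on
  the relations of the generalized Grassmann algebra, which is what makes the sorted product free.
\<close>

definition ml_coeff :: "nat \<Rightarrow> 'c ceps free_alg \<Rightarrow> 'c::{comm_ring, comm_monoid_mult} ceps"
  where "ml_coeff n =
    linext (\<lambda>w a. if sort (letters w) = [0..<n] then a * list_sgn eps (letters w) else 0)"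

lemma ml_coeff_add: "ml_coeff n (p + q) = ml_coeff n p + ml_coeff n q"
  unfolding ml_coeff_def by (rule linext_add) (simp_all add: distrib_right)

lemma ml_coeff_diff: "ml_coeff n (p - q) = ml_coeff n p - ml_coeff n q"
  by (metis add_diff_cancel diff_add_cancel ml_coeff_add)

lemma ml_coeff_zero [simp]: "ml_coeff n 0 = 0"
  by (simp add: ml_coeff_def)

lemma ml_coeff_single: "ml_coeff n (Poly_Mapping.single w a)
    = (if sort (letters w) = [0..<n] then a * list_sgn eps (letters w) else 0)"
  unfolding ml_coeff_def by (rule linext_single) simp

text \<open>
  The two-sided multipliers \<open>p\<close> and \<open>q\<close> make the induction over the ideal go through. For a
  relation between words \<open>u\<close> and \<open>v\<close>, the letters \<open>i\<close> and \<open>j\<close> are distinct whenever the functional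
  sees the word at all, and exchanging them changes the sign by the factor \<open>1 - \<epsilon>\<^sub>i \<epsilon>\<^sub>j\<close>.
\<close>

lemma ml_coeff_ideal:
  fixes r :: "'c::{comm_ring, comm_monoid_mult} ceps free_alg"
  assumes "r \<in> ideal_gen galg_rels"
  shows "ml_coeff n (p * r * q) = 0"
  using assms
proof (induction arbitrary: p q)
  case (ideal_gen_base r)
  then obtain i j where r: "r = Xvar i * Xvar j - Xvar j * Xvar i
      - Poly_Mapping.single 0 (eps i * eps j) * Xvar i * Xvar j"
    by (auto simp: galg_rels_def)
  show ?case
  proof (induction p rule: pm_induct)
    case (single u a)
    show ?case
    proof (induction q rule: pm_induct)
      case (single v b)
      obtain u' v' where uv: "u = Word u'" "v = Word v'"
        by (metis word.exhaust)
      let ?ij = "u' @ i # j # v'" and ?ji = "u' @ j # i # v'"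
      have sort: "sort ?ji = sort ?ij"
        by (rule properties_for_sort) simp_all
      have eq: "Poly_Mapping.single u a * r * Poly_Mapping.single v b
          = Poly_Mapping.single (Word ?ij) (a * b) - Poly_Mapping.single (Word ?ji) (a * b)
            - Poly_Mapping.single (Word ?ij) (eps i * eps j * (a * b))"
        unfolding r uv
        by (simp add: mult_single left_diff_distrib right_diff_distrib plus_word_def zero_word_def
            ac_simps)
      have swap: "list_sgn eps ?ji = (1 - eps i * eps j) * (list_sgn eps ?ij :: 'c ceps)"
        if "sort ?ij = [0..<n]"
      proof (rule list_sgn_swap)
        have "distinct (sort ?ij)" using that by simp
        then show "i \<noteq> j" by (auto simp only: distinct_sort distinct_append distinct.simps) simp
      qed (rule ceps_relations)+
      show ?case
        unfolding eq
        by (simp add: ml_coeff_diff ml_coeff_single sort swap) (simp add: algebra_simps)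
    qed (simp_all add: distrib_left ml_coeff_add)
  qed (simp_all add: distrib_right ml_coeff_add)
next
  case (ideal_gen_left a r)
  then show ?case using ideal_gen_left.IH[of "p * r" q] by (simp add: mult.assoc)
next
  case (ideal_gen_right a r)
  then show ?case using ideal_gen_right.IH[of p "r * q"] by (simp add: mult.assoc)
qed (simp_all add: left_diff_distrib right_diff_distrib ml_coeff_diff)

text \<open>
  Products with a repeated generator can have annihilators, as in \<open>\<theta> \<epsilon>\<^sub>i e\<^sub>i e\<^sub>i = 0\<close>.
  The product of distinct generators is free because \<open>ml_coeff\<close> descends to the quotient.
\<close>

lemma multilinear_coeff_unique:
  assumes "galg_of a * prod_list (map gen_e [0..<n]) = galg_of b * prod_list (map gen_e [0..<n])"
  shows "a = b"
proof -
  let ?w = "Word [0..<n]"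
  have "Poly_Mapping.single ?w a - Poly_Mapping.single ?w b \<in> ideal_gen galg_rels"
    using assms by (simp flip: abs_galg_single add: galg.abs_eq_iff)
  from ml_coeff_ideal[OF this, of n "Poly_Mapping.single 0 1" "Poly_Mapping.single 0 1"]
  show ?thesis
    by (simp add: ml_coeff_diff ml_coeff_single list_sgn_sorted sorted_sort_id)
qed

text \<open>
  The cocycle identity behind the action on \<open>C[\<epsilon>]\<close>. The product of the generators in the order
  \<open>\<tau> \<circ> \<sigma>\<close> can be sorted at once, or by sorting the family \<open>i \<mapsto> e\<^bsub>\<tau> i\<^esub>\<close> along \<open>\<sigma>\<close> first and the
  generators along \<open>\<tau>\<close> afterwards; freeness allows the comparison of the two coefficients.
\<close>

lemma gen_sgn_comp:
  assumes "\<tau> permutes {..<n}" "\<sigma> permutes {..<n}"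
  shows "gen_sgn n (\<tau> \<circ> \<sigma>) = gen_sgn n \<tau> * phi \<tau> (gen_sgn n \<sigma>)"
proof (rule multilinear_coeff_unique)
  let ?E = "prod_list (map gen_e [0..<n])"
  have e: "sgn_commuting gen_e eps"
    using sgn_commuting_gen_e[of id] by simp
  have "galg_of (gen_sgn n (\<tau> \<circ> \<sigma>)) * ?E = prod_list (map gen_e (map (\<tau> \<circ> \<sigma>) [0..<n]))"
    unfolding prod_permuted[OF e permutes_compose[OF assms(2,1)]] gen_sgn_list ..
  also have "\<dots> = prod_list (map (\<lambda>i. gen_e (\<tau> i)) (map \<sigma> [0..<n]))"
    by (simp add: o_def)
  also have "\<dots> = galg_of (phi \<tau> (gen_sgn n \<sigma>)) * prod_list (map gen_e (map \<tau> [0..<n]))"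
    unfolding prod_permuted[OF sgn_commuting_gen_e assms(2)]
    by (simp add: gen_sgn_list phi_list_sgn o_def)
  also have "\<dots> = galg_of (phi \<tau> (gen_sgn n \<sigma>)) * (galg_of (gen_sgn n \<tau>) * ?E)"
    unfolding prod_permuted[OF e assms(1)] by (simp add: gen_sgn_list)
  finally show "galg_of (gen_sgn n (\<tau> \<circ> \<sigma>)) * ?E
      = galg_of (gen_sgn n \<tau> * phi \<tau> (gen_sgn n \<sigma>)) * ?E"
    by (simp add: galg_of_merge mult.commute)
qed

section \<open>Multilinear identities\<close>

definition ml_poly :: "nat \<Rightarrow> ((nat \<Rightarrow> nat) \<Rightarrow> 'c) \<Rightarrow> 'c::{comm_ring, comm_monoid_mult} free_alg"
  where "ml_poly n \<alpha> =
    (\<Sum>\<sigma> | \<sigma> permutes {..<n}. Poly_Mapping.single (Word (map \<sigma> [0..<n])) (\<alpha> \<sigma>))"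

lemma mcarrier_multilinear: "mcarrier (multilinear n) = range (ml_poly n)"
  by (auto simp: multilinear_def ml_poly_def)

lemma finite_perms: "finite {\<sigma>. \<sigma> permutes {..<n::nat}}"
  by (rule finite_permutations) simp

lemma linext_ml_poly:
  assumes zero: "\<And>k. g k 0 = 0" and add: "\<And>k a b. g k (a + b) = g k a + g k b"
  shows "linext g (ml_poly n \<alpha>) = (\<Sum>\<sigma> | \<sigma> permutes {..<n}. g (Word (map \<sigma> [0..<n])) (\<alpha> \<sigma>))"
proof -
  have "linext g (\<Sum>\<sigma>\<in>A. Poly_Mapping.single (Word (map \<sigma> [0..<n])) (\<alpha> \<sigma>))
      = (\<Sum>\<sigma>\<in>A. g (Word (map \<sigma> [0..<n])) (\<alpha> \<sigma>))" if "finite A" for A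
    using that by (induction A) (simp_all add: linext_add[of g, OF zero add] linext_single[of g, OF zero])
  then show ?thesis
    unfolding ml_poly_def by (simp add: finite_perms)
qed

lemma free_eval_ml_poly: "free_eval galg_scale s (ml_poly n \<alpha>)
    = (\<Sum>\<sigma> | \<sigma> permutes {..<n}. galg_of (ceps_of (\<alpha> \<sigma>)) * prod_list (map s (map \<sigma> [0..<n])))"
proof -
  have "free_eval galg_scale s = linext (\<lambda>w c. galg_of (ceps_of c) * prod_list (map s (letters w)))"
    by (simp add: fun_eq_iff free_eval_def linext_def galg_scale_def)
  then show ?thesis
    by (simp add: linext_ml_poly ceps_of_hom galg_of_hom distrib_right)
qed

definition sgn_map :: "'c free_alg \<Rightarrow> 'c::{comm_ring, comm_monoid_mult} ceps"
  where "sgn_map = linext (\<lambda>w c. ceps_of c * list_sgn eps (letters w))"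

lemma sgn_map_add: "sgn_map (f + g) = sgn_map f + sgn_map g"
  unfolding sgn_map_def by (rule linext_add) (simp_all add: ceps_of_hom distrib_right)

lemma sgn_map_ml_poly:
  "sgn_map (ml_poly n \<alpha>) = (\<Sum>\<sigma> | \<sigma> permutes {..<n}. ceps_of (\<alpha> \<sigma>) * gen_sgn n \<sigma>)"
  unfolding sgn_map_def
  by (subst linext_ml_poly) (simp_all add: ceps_of_hom distrib_right gen_sgn_list)

lemma galg_of_sum: "galg_of (\<Sum>i\<in>A. f i) = (\<Sum>i\<in>A. galg_of (f i))"
  by (induction A rule: infinite_finite_induct) (simp_all add: galg_of_hom)

text \<open>
  Evaluating at a family that commutes according to \<open>\<eta>\<close> amounts to evaluating at the generators
  and then substituting \<open>\<eta>\<^sub>i\<close> for \<open>\<epsilon>\<^sub>i\<close> in the coefficient of the sorted product.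
\<close>

lemma free_eval_sgn_commuting:
  assumes "sgn_commuting s \<eta>" "\<And>i. \<eta> i * \<eta> i = theta * \<eta> i"
  shows "free_eval galg_scale s (ml_poly n \<alpha>)
    = galg_of (ceps_subst \<eta> (sgn_map (ml_poly n \<alpha>))) * prod_list (map s [0..<n])"
proof -
  note hom = ceps_subst_hom[of \<eta>, OF assms(2)]
  have sum: "ceps_subst \<eta> (\<Sum>i\<in>A. f i) = (\<Sum>i\<in>A. ceps_subst \<eta> (f i))" for f and A :: "(nat \<Rightarrow> nat) set"
    by (induction A rule: infinite_finite_induct) (simp_all add: hom)
  have sgn: "ceps_subst \<eta> (gen_sgn n \<sigma>) = list_sgn \<eta> (map \<sigma> [0..<n])" for \<sigma>
    unfolding gen_sgn_list by (subst list_sgn_hom[where h = "ceps_subst \<eta>"]) (simp_all add: hom)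
  have "free_eval galg_scale s (ml_poly n \<alpha>)
      = (\<Sum>\<sigma> | \<sigma> permutes {..<n}. galg_of (ceps_of (\<alpha> \<sigma>) * list_sgn \<eta> (map \<sigma> [0..<n]))
          * prod_list (map s [0..<n]))"
    unfolding free_eval_ml_poly
    by (rule sum.cong) (simp_all only: mem_Collect_eq prod_permuted[OF assms(1)] galg_of_merge)
  also have "\<dots> = galg_of (ceps_subst \<eta> (sgn_map (ml_poly n \<alpha>))) * prod_list (map s [0..<n])"
    by (simp add: sgn_map_ml_poly sum sgn hom galg_of_sum sum_distrib_right)
  finally show ?thesis .
qed

text \<open>
  The element that plays the role of \<open>\<epsilon>\<close> for a monomial. The operation
  \<open>(a, b) \<mapsto> a + b - \<theta> a b\<close> comes from \<open>(1 - a c) (1 - b c) = 1 - (a + b - \<theta> a b) c\<close>: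
  exchanging \<open>c\<close> with two letters in turn is the same as exchanging it with one letter whose
  parameter is the combined one.
\<close>

fun word_eps :: "nat list \<Rightarrow> 'c::{comm_ring, comm_monoid_mult} ceps"
  where
    "word_eps [] = 0"
  | "word_eps (x # xs) = eps x + word_eps xs - theta * eps x * word_eps xs"

lemma theta_idempotent_join:
  fixes a b t :: "'r::{comm_ring, comm_monoid_mult}"
  assumes t: "t * t = 1 + 1" and a: "a * a = t * a" and b: "b * b = t * b"
  shows "(a + b - t * a * b) * (a + b - t * a * b) = t * (a + b - t * a * b)"
proof -
  \<comment> \<open>The combined element is \<open>a + b u\<close> for an involution \<open>u\<close> with \<open>a u = - a\<close>.\<close>
  define u where "u = 1 - t * a"
  have taa: "t * (a * a) = a + a"
    unfolding a by (simp add: t distrib_right flip: mult.assoc)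
  have au: "a * u = - a"
    by (simp add: u_def right_diff_distrib taa mult.left_commute[of a t])
  have uu: "u * u = 1"
  proof -
    have "u * u = u - t * (a * u)"
      by (simp add: u_def left_diff_distrib mult.assoc)
    also have "\<dots> = 1" unfolding au by (simp add: u_def)
    finally show ?thesis .
  qed
  have join: "a + b - t * a * b = a + b * u"
    by (simp add: u_def right_diff_distrib ac_simps)
  have "(a + b * u) * (a + b * u) = a * a + b * (a * u) + b * (a * u) + (b * b) * (u * u)"
    by (simp add: distrib_left distrib_right ac_simps)
  also have "\<dots> = t * a + t * b - (b * a + b * a)"
    unfolding au uu a b by (simp add: algebra_simps)
  also have "b * a + b * a = (t * t) * (a * b)"
    unfolding t by (simp add: distrib_right mult.commute)
  also have "(t * t) * (a * b) = t * (t * a * b)"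
    by (simp only: mult.assoc)
  finally show ?thesis
    unfolding join[symmetric] by (simp add: distrib_left right_diff_distrib)
qed

lemma word_eps_square: "word_eps w * word_eps w = theta * word_eps w"
  by (induction w) (simp_all only: word_eps.simps mult_zero_left mult_zero_right
      theta_idempotent_join[OF ceps_relations])

lemma sign_factor_join:
  fixes a b c t :: "'r::{comm_ring, comm_monoid_mult}"
  assumes "c * c = t * c"
  shows "(1 - a * c) * (1 - b * c) = 1 - (a + b - t * a * b) * c"
proof -
  have "a * b * (c * c) = t * a * b * c"
    unfolding assms by (simp only: ac_simps)
  then show ?thesis by (simp add: algebra_simps)
qed

lemma gen_e_word_commute:
  "(gen_e x :: 'c::{comm_ring, comm_monoid_mult} galg) * prod_list (map gen_e w)
    = galg_of (1 - eps x * word_eps w) * (prod_list (map gen_e w) * gen_e x)"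
proof (induction w)
  case Nil
  show ?case by (simp add: galg_of_hom)
next
  case (Cons y w)
  let ?E = "prod_list (map gen_e w) :: 'c galg"
  have "gen_e x * (prod_list (map gen_e (y # w)) :: 'c galg) = (gen_e x * gen_e y) * ?E"
    by (simp add: mult.assoc)
  also have "\<dots> = galg_of (1 - eps x * eps y) * (gen_e y * (gen_e x * ?E))"
    by (subst gen_e_commute) (simp add: mult.assoc)
  also have "\<dots> = galg_of ((1 - eps x * eps y) * (1 - eps x * word_eps w)) * (gen_e y * ?E * gen_e x)"
    unfolding Cons.IH galg_of_left_commute[of "gen_e y"] galg_of_merge by (simp add: mult.assoc)
  also have "(1 - eps x * eps y) * (1 - eps x * word_eps w) = 1 - eps x * word_eps (y # w)"
    using sign_factor_join[of "eps x" theta "eps y" "word_eps w"]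
    by (simp add: ceps_relations mult.commute)
  finally show ?case by simp
qed

lemma word_word_commute:
  "(prod_list (map gen_e v) :: 'c::{comm_ring, comm_monoid_mult} galg) * prod_list (map gen_e w)
    = galg_of (1 - word_eps v * word_eps w) * (prod_list (map gen_e w) * prod_list (map gen_e v))"
proof (induction v)
  case Nil
  show ?case by (simp add: galg_of_hom)
next
  case (Cons x v)
  let ?V = "prod_list (map gen_e v)" and ?W = "prod_list (map gen_e w) :: 'c galg"
  have "prod_list (map gen_e (x # v)) * ?W = gen_e x * (?V * ?W)"
    by (simp add: mult.assoc)
  also have "\<dots> = galg_of (1 - word_eps v * word_eps w) * (gen_e x * ?W * ?V)"
    unfolding Cons.IH galg_of_left_commute[of "gen_e x"] by (simp add: mult.assoc)
  also have "\<dots> = galg_of ((1 - word_eps v * word_eps w) * (1 - eps x * word_eps w))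
      * (?W * (gen_e x * ?V))"
    unfolding gen_e_word_commute[of x w] mult.assoc[of "galg_of _"] galg_of_merge by (simp add: mult.assoc)
  also have "(1 - word_eps v * word_eps w) * (1 - eps x * word_eps w)
      = 1 - word_eps (x # v) * word_eps w"
    using sign_factor_join[OF word_eps_square[of w], of "eps x" "word_eps v"]
    by (simp add: mult.commute)
  finally show ?case by simp
qed

definition galg_monomial :: "'c::{comm_ring, comm_monoid_mult} galg \<Rightarrow> bool"
  where "galg_monomial x \<longleftrightarrow> (\<exists>a w. x = galg_of a * prod_list (map gen_e w))"

lemma galg_monomial_one: "galg_monomial 1"
  unfolding galg_monomial_def by (rule exI[of _ 1], rule exI[of _ "[]"]) (simp add: galg_of_hom)

lemma monomials_sgn_commuting:
  assumes "\<And>i. galg_monomial (s i)"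
  shows "\<exists>\<eta>. sgn_commuting s \<eta> \<and> (\<forall>i. \<eta> i * \<eta> i = theta * \<eta> i)"
proof -
  from assms obtain a w where s: "s i = galg_of (a i) * prod_list (map gen_e (w i))" for i
    unfolding galg_monomial_def by metis
  have scaled: "galg_of b * x * (galg_of c * y) = galg_of (b * c) * (x * y)" for b c x y
    by (simp only: mult.assoc galg_of_left_commute[of x] galg_of_merge)
  have "sgn_commuting s (\<lambda>i. word_eps (w i))"
    unfolding sgn_commuting_def s scaled
  proof (intro allI)
    fix i j
    show "galg_of (a i * a j) * (prod_list (map gen_e (w i)) * prod_list (map gen_e (w j)))
        = galg_of (1 - word_eps (w i) * word_eps (w j))
          * (galg_of (a j * a i) * (prod_list (map gen_e (w j)) * prod_list (map gen_e (w i))))"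
      unfolding word_word_commute[of "w i" "w j"] galg_of_merge by (simp only: mult.commute)
  qed
  then show ?thesis
    using word_eps_square by blast
qed

lemma galg_induct [case_names zero monomial add]:
  assumes "P 0" "\<And>x. galg_monomial x \<Longrightarrow> P x" "\<And>x y. P x \<Longrightarrow> P y \<Longrightarrow> P (x + y)"
  shows "P x"
proof -
  have "P (abs_galg p)" for p
  proof (induction p rule: pm_induct)
    case (single k c)
    have "galg_monomial (abs_galg (Poly_Mapping.single k c))"
      unfolding galg_monomial_def by (cases k) (use abs_galg_single in blast)
    then show ?case by (rule assms(2))
  qed (use assms in \<open>simp_all add: zero_galg_def flip: plus_galg.abs_eq\<close>)
  then show ?thesis
    by (induction x rule: galg.abs_induct)
qed

lemma prod_list_update_add:
  fixes x y :: "'a::{ring, monoid_mult}"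
  assumes "distinct ks" "k \<in> set ks"
  shows "prod_list (map (s(k := x + y)) ks)
    = prod_list (map (s(k := x)) ks) + prod_list (map (s(k := y)) ks)"
  using assms
  by (induction ks) (auto simp: distrib_left distrib_right)

lemma free_eval_update_add:
  assumes "k < n"
  shows "free_eval galg_scale (s(k := x + y)) (ml_poly n \<alpha>)
    = free_eval galg_scale (s(k := x)) (ml_poly n \<alpha>) + free_eval galg_scale (s(k := y)) (ml_poly n \<alpha>)"
proof -
  have "prod_list (map (s(k := x + y)) (map \<sigma> [0..<n]))
      = prod_list (map (s(k := x)) (map \<sigma> [0..<n])) + prod_list (map (s(k := y)) (map \<sigma> [0..<n]))"
    if "\<sigma> permutes {..<n}" for \<sigma>
  proof (rule prod_list_update_add)
    show "distinct (map \<sigma> [0..<n])"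
      using permutes_inj_on[OF that] by (simp add: distinct_map)
    show "k \<in> set (map \<sigma> [0..<n])"
      using permutes_image[OF that] assms by (simp add: atLeast0LessThan)
  qed
  then show ?thesis
    unfolding free_eval_ml_poly sum.distrib[symmetric]
    by (intro sum.cong) (simp_all only: mem_Collect_eq distrib_left)
qed

text \<open>
  A multilinear polynomial is additive in each of its variables, so the variables
  \<open>k = 0, \<dots>, n - 1\<close> can be freed one at a time from the restriction to monomials.
\<close>

lemma multilinear_identity:
  fixes s :: "nat \<Rightarrow> 'c::{comm_ring, comm_monoid_mult} galg"
  assumes "\<And>s. (\<And>i. galg_monomial (s i)) \<Longrightarrow> free_eval galg_scale s (ml_poly n \<alpha>) = 0"
  shows "free_eval galg_scale s (ml_poly n \<alpha>) = 0"
proof -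
  let ?F = "\<lambda>s. free_eval galg_scale s (ml_poly n \<alpha>)"
  have partial: "?F s = 0" if "k \<le> n" "\<And>i. i \<ge> k \<Longrightarrow> galg_monomial (s i)" for k s
    using that
  proof (induction k arbitrary: s)
    case 0
    then show ?case by (intro assms) simp
  next
    case (Suc k)
    then have add: "?F (s(k := x + y)) = ?F (s(k := x)) + ?F (s(k := y))" for x y
      by (intro free_eval_update_add) simp
    have "?F (s(k := x)) = 0" for x
    proof (induction x rule: galg_induct)
      case zero
      show ?case using add[of 0 0] by (simp del: fun_upd_apply)
    next
      case (monomial x)
      show ?case
        by (rule Suc.IH) (use Suc.prems monomial in \<open>auto simp: Suc_le_eq\<close>)
    qed (simp add: add del: fun_upd_apply)
    from this[of "s k"] show ?case by simp
  qed
  \<comment> \<open>Values at indices \<open>\<ge> n\<close> do not occur, so they may be replaced by the monomial \<open>1\<close>.\<close>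
  have "?F s = ?F (\<lambda>i. if i < n then s i else 1)"
    unfolding free_eval_ml_poly
  proof (intro sum.cong arg_cong2[of _ _ _ _ "(*)"] arg_cong[of _ _ prod_list] refl)
    fix \<sigma> assume "\<sigma> \<in> {\<sigma>. \<sigma> permutes {..<n}}"
    then show "map s (map \<sigma> [0..<n]) = map (\<lambda>i. if i < n then s i else 1) (map \<sigma> [0..<n])"
      using permutes_in_image[of \<sigma> "{..<n}"] by auto
  qed
  also have "\<dots> = 0"
    by (rule partial[OF order_refl]) (simp add: galg_monomial_one)
  finally show ?thesis .
qed

lemma ml_poly_in_poly_ids_iff:
  "ml_poly n \<alpha> \<in> poly_ids (galg_scale :: 'c::{comm_ring, comm_monoid_mult} \<Rightarrow> 'c galg \<Rightarrow> 'c galg)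
    \<longleftrightarrow> sgn_map (ml_poly n \<alpha>) = 0"
proof
  assume "ml_poly n \<alpha> \<in> poly_ids (galg_scale :: 'c \<Rightarrow> 'c galg \<Rightarrow> 'c galg)"
  then have "free_eval galg_scale gen_e (ml_poly n \<alpha>) = 0"
    by (simp add: poly_ids_def)
  moreover have e: "sgn_commuting gen_e eps"
    using sgn_commuting_gen_e[of id] by simp
  have "free_eval galg_scale gen_e (ml_poly n \<alpha>)
      = galg_of (sgn_map (ml_poly n \<alpha>)) * prod_list (map gen_e [0..<n])"
    unfolding free_eval_ml_poly sgn_map_ml_poly galg_of_sum sum_distrib_right
    by (rule sum.cong) (simp_all only: mem_Collect_eq prod_permuted[OF e] galg_of_merge gen_sgn_list)
  ultimately have "galg_of (sgn_map (ml_poly n \<alpha>)) * prod_list (map gen_e [0..<n])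
      = galg_of 0 * prod_list (map gen_e [0..<n])"
    by (simp add: galg_of_hom)
  then show "sgn_map (ml_poly n \<alpha>) = 0"
    by (rule multilinear_coeff_unique)
next
  assume zero: "sgn_map (ml_poly n \<alpha>) = 0"
  have "free_eval galg_scale s (ml_poly n \<alpha>) = 0"
    if monomial: "\<And>i. galg_monomial (s i)" for s :: "nat \<Rightarrow> 'c galg"
  proof -
    from monomials_sgn_commuting[of s, OF monomial] obtain \<eta> where
      \<eta>: "sgn_commuting s \<eta>" "\<And>i. \<eta> i * \<eta> i = theta * \<eta> i"
      by metis
    show ?thesis
      by (simp add: free_eval_sgn_commuting[OF \<eta>] zero ceps_subst_hom(6)[of \<eta>, OF \<eta>(2)] galg_of_hom)
  qed
  then have "free_eval galg_scale s (ml_poly n \<alpha>) = 0" for s :: "nat \<Rightarrow> 'c galg"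
    by (rule multilinear_identity)
  then show "ml_poly n \<alpha> \<in> poly_ids (galg_scale :: 'c \<Rightarrow> 'c galg \<Rightarrow> 'c galg)"
    by (simp add: poly_ids_def)
qed

section \<open>The sign map as a module homomorphism\<close>

lemma ml_poly_add: "ml_poly n \<alpha> + ml_poly n \<beta> = ml_poly n (\<lambda>\<sigma>. \<alpha> \<sigma> + \<beta> \<sigma>)"
  by (simp add: ml_poly_def single_add sum.distrib)

lemma ml_poly_diff: "ml_poly n \<alpha> - ml_poly n \<beta> = ml_poly n (\<lambda>\<sigma>. \<alpha> \<sigma> - \<beta> \<sigma>)"
  by (simp add: ml_poly_def single_diff sum_subtractf)

lemma ml_poly_scale: "Poly_Mapping.single 0 c * ml_poly n \<alpha> = ml_poly n (\<lambda>\<sigma>. c * \<alpha> \<sigma>)"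
  by (simp add: ml_poly_def sum_distrib_left mult_single)

text \<open>
  In the stored coefficient family, the action of \<open>\<tau>\<close> is translation by \<open>inv \<tau>\<close>; in particular it maps
  multilinear polynomials to multilinear polynomials.
\<close>

lemma ml_poly_act:
  assumes "\<tau> permutes {..<n}"
  shows "push (\<lambda>w. Word (map \<tau> (letters w))) (ml_poly n \<alpha>) = ml_poly n (\<lambda>\<sigma>. \<alpha> (inv \<tau> \<circ> \<sigma>))"
proof -
  let ?t = "\<lambda>w. Word (map \<tau> (letters w))"
  have "push ?t (\<Sum>\<sigma>\<in>A. Poly_Mapping.single (Word (map \<sigma> [0..<n])) (\<alpha> \<sigma>))
      = (\<Sum>\<sigma>\<in>A. Poly_Mapping.single (Word (map (\<tau> \<circ> \<sigma>) [0..<n])) (\<alpha> \<sigma>))" if "finite A" for A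
    using that by (induction A) (simp_all add: push_add o_def)
  then have "push ?t (ml_poly n \<alpha>)
      = (\<Sum>\<sigma> | \<sigma> permutes {..<n}. Poly_Mapping.single (Word (map (\<tau> \<circ> \<sigma>) [0..<n])) (\<alpha> \<sigma>))"
    by (simp add: ml_poly_def finite_perms)
  also have "\<dots> = (\<Sum>\<sigma> | \<sigma> permutes {..<n}.
      Poly_Mapping.single (Word (map (\<tau> \<circ> \<sigma>) [0..<n])) (\<alpha> (inv \<tau> \<circ> (\<tau> \<circ> \<sigma>))))"
    by (simp add: permutes_inv_o(2)[OF assms] flip: o_assoc[symmetric])
  also have "\<dots> = ml_poly n (\<lambda>\<sigma>. \<alpha> (inv \<tau> \<circ> \<sigma>))"
    unfolding ml_poly_def by (rule sym, rule setum_permutations_compose_left[OF assms])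
  finally show ?thesis .
qed

lemma sgn_map_scale: "sgn_map (ml_poly n (\<lambda>\<sigma>. c * \<alpha> \<sigma>)) = ceps_of c * sgn_map (ml_poly n \<alpha>)"
  by (simp add: sgn_map_ml_poly sum_distrib_left ceps_of_hom mult.assoc)

lemma sgn_map_act:
  assumes "\<tau> permutes {..<n}"
  shows "sgn_map (ml_poly n (\<lambda>\<sigma>. \<alpha> (inv \<tau> \<circ> \<sigma>)))
    = gen_sgn n \<tau> * phi \<tau> (sgn_map (ml_poly n \<alpha>))"
proof -
  have phi_sum: "phi \<tau> (\<Sum>i\<in>A. f i) = (\<Sum>i\<in>A. phi \<tau> (f i))" for f and A :: "(nat \<Rightarrow> nat) set"
    by (induction A rule: infinite_finite_induct) (simp_all add: phi_hom phi_zero_one_diff)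
  have "sgn_map (ml_poly n (\<lambda>\<sigma>. \<alpha> (inv \<tau> \<circ> \<sigma>)))
      = (\<Sum>\<sigma> | \<sigma> permutes {..<n}. ceps_of (\<alpha> (inv \<tau> \<circ> (\<tau> \<circ> \<sigma>))) * gen_sgn n (\<tau> \<circ> \<sigma>))"
    unfolding sgn_map_ml_poly by (rule setum_permutations_compose_left[OF assms])
  also have "\<dots> = (\<Sum>\<sigma> | \<sigma> permutes {..<n}. ceps_of (\<alpha> \<sigma>) * (gen_sgn n \<tau> * phi \<tau> (gen_sgn n \<sigma>)))"
    by (rule sum.cong) (simp_all add: permutes_inv_o(2)[OF assms] gen_sgn_comp[OF assms] o_assoc)
  also have "\<dots> = gen_sgn n \<tau> * phi \<tau> (sgn_map (ml_poly n \<alpha>))"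
    by (simp add: sgn_map_ml_poly phi_sum phi_hom sum_distrib_left mult.left_commute)
  finally show ?thesis .
qed

lemma gen_sgn_id: "gen_sgn n id = 1"
  by (simp add: gen_sgn_list list_sgn_sorted)

text \<open>
  A submodule that contains \<open>1\<close> contains every \<open>gen_sgn n \<sigma> \<cdot> phi \<sigma> 1 = gen_sgn n \<sigma>\<close> and
  hence the whole image. The image is itself such a submodule, by equivariance of \<open>sgn_map\<close>.
\<close>

lemma sgn_map_image:
  "sgn_map ` mcarrier (multilinear n)
    = mcarrier (gen_signs n :: ('c::{comm_ring, comm_monoid_mult}, _) sn_module)"
proof
  let ?V = "sgn_map ` range (ml_poly n :: _ \<Rightarrow> 'c free_alg)"
  show "sgn_map ` mcarrier (multilinear n) \<subseteq> mcarrier (gen_signs n :: ('c, _) sn_module)"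
  proof -
    have "sgn_map (ml_poly n \<alpha>) \<in> N"
      if N: "sn_submodule n N (ceps_module n :: ('c, _) sn_module)" and one: "1 \<in> N" for \<alpha> N
    proof -
      have "ceps_of (\<alpha> \<sigma>) * gen_sgn n \<sigma> \<in> N" if "\<sigma> permutes {..<n}" for \<sigma>
      proof -
        have "gen_sgn n \<sigma> * phi \<sigma> 1 \<in> N"
          using N one that unfolding sn_submodule_def ceps_module_def by simp
        then show ?thesis
          using N unfolding sn_submodule_def ceps_module_def by (simp add: phi_zero_one_diff)
      qed
      moreover have "0 \<in> N" "\<And>a b. a \<in> N \<Longrightarrow> b \<in> N \<Longrightarrow> a + b \<in> N"
        using N unfolding sn_submodule_def ceps_module_def by simp_all
      ultimately have "(\<Sum>\<sigma>\<in>A. ceps_of (\<alpha> \<sigma>) * gen_sgn n \<sigma>) \<in> N"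
        if "A \<subseteq> {\<sigma>. \<sigma> permutes {..<n}}" for A
        using that by (induction A rule: infinite_finite_induct) auto
      then show ?thesis
        unfolding sgn_map_ml_poly by blast
    qed
    then show ?thesis
      by (auto simp: mcarrier_multilinear gen_signs_def sn_generated_def)
  qed
  have "sn_submodule n ?V (ceps_module n)"
    unfolding sn_submodule_def ceps_module_def
  proof (simp, intro conjI ballI allI impI)
    show "0 \<in> ?V"
      by (rule image_eqI[OF _ rangeI[of _ "\<lambda>_. 0"]]) (simp add: sgn_map_ml_poly ceps_of_hom)
  qed (auto simp: ml_poly_add sgn_map_scale[symmetric] sgn_map_act[symmetric] simp flip: sgn_map_add)
  moreover have "1 \<in> ?V"
  proof (rule image_eqI[OF _ rangeI[of _ "\<lambda>\<sigma>. if \<sigma> = id then 1 else 0"]])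
    have "sgn_map (ml_poly n (\<lambda>\<sigma>. if \<sigma> = id then 1 else 0 :: 'c))
        = (\<Sum>\<sigma> | \<sigma> permutes {..<n}. if \<sigma> = id then 1 else 0)"
      unfolding sgn_map_ml_poly by (rule sum.cong) (simp_all add: ceps_of_hom gen_sgn_id)
    then show "1 = sgn_map (ml_poly n (\<lambda>\<sigma>. if \<sigma> = id then 1 else 0 :: 'c))"
      by (simp add: sum.delta finite_perms permutes_id)
  qed
  ultimately show "mcarrier (gen_signs n) \<subseteq> sgn_map ` mcarrier (multilinear n :: ('c, _) sn_module)"
    by (auto simp: mcarrier_multilinear gen_signs_def sn_generated_def)
qed

section \<open>Passage to the quotient\<close>

text \<open>
  The operations on cosets are unions over all representatives. All elements of such a union
  have the same image under \<open>h\<close>, so the induced map can be evaluated at any one of them, and the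
  union itself need not be identified with a single coset.
\<close>

lemma sn_first_isomorphism:
  fixes M :: "('c, 'm::ab_group_add) sn_module" and N :: "('c, 'k::ab_group_add) sn_module"
  assumes madd: "madd M = (+)" "madd N = (+)"
    and closed: "\<And>a b. a \<in> mcarrier M \<Longrightarrow> b \<in> mcarrier M \<Longrightarrow> a + b \<in> mcarrier M"
      "\<And>a b. a \<in> mcarrier M \<Longrightarrow> b \<in> mcarrier M \<Longrightarrow> a - b \<in> mcarrier M"
    and add: "\<And>a b. h (a + b) = h a + h b"
    and scale: "\<And>c a. a \<in> mcarrier M \<Longrightarrow> h (mscale M c a) = mscale N c (h a)"
    and act: "\<And>\<sigma> a. \<sigma> permutes {..<n} \<Longrightarrow> a \<in> mcarrier M \<Longrightarrow> h (mact M \<sigma> a) = mact N \<sigma> (h a)"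
    and kernel: "\<And>a. a \<in> K \<longleftrightarrow> a \<in> mcarrier M \<and> h a = 0"
    and image: "h ` mcarrier M = mcarrier N"
  shows "sn_isomorphic n (sn_quotient M K) N"
proof -
  define F where "F A = h (SOME a. a \<in> A)" for A
  \<comment> \<open>The value at a set on which \<open>h\<close> is constant.\<close>
  have F: "F A = v" if "a \<in> A" "\<And>x. x \<in> A \<Longrightarrow> h x = v" for A a v
    unfolding F_def by (rule that(2)) (rule someI, rule that(1))
  have h_zero: "h 0 = 0" using add[of 0 0] by simp
  have self: "a \<in> mcoset M K a" if "b \<in> mcarrier M" for a b
    using closed(2)[OF that that] h_zero unfolding mcoset_def madd
    by (auto simp: kernel intro!: exI[of _ 0])
  have h_coset: "h x = h a" if "x \<in> mcoset M K a" for x a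
    using that by (auto simp: mcoset_def madd add kernel)
  have coset_carrier: "x \<in> mcarrier M" if "x \<in> mcoset M K a" "a \<in> mcarrier M" for x a
    using that closed(1) by (auto simp: mcoset_def madd kernel)
  have F_coset: "F (mcoset M K a) = h a" if "a \<in> mcarrier M" for a
    using F[OF self[OF that]] h_coset by blast
  have "inj_on F (mcoset M K ` mcarrier M)"
  proof (rule inj_onI, clarsimp simp: F_coset)
    fix a b assume a: "a \<in> mcarrier M" and b: "b \<in> mcarrier M" and eq: "h a = h b"
    have sub: "mcoset M K a \<subseteq> mcoset M K b"
      if a: "a \<in> mcarrier M" and b: "b \<in> mcarrier M" and eq: "h a = h b" for a b
    proof
      fix x assume "x \<in> mcoset M K a"
      then obtain k where k: "k \<in> K" "x = a + k" by (auto simp: mcoset_def madd)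
      have "h (a - b) = 0" using add[of "a - b" b] eq by simp
      with a b k(1) have "a - b + k \<in> K" by (simp add: kernel closed add)
      moreover have "x = b + (a - b + k)" by (simp add: k)
      ultimately show "x \<in> mcoset M K b" unfolding mcoset_def madd by blast
    qed
    show "mcoset M K a = mcoset M K b"
      using sub[OF a b eq] sub[OF b a eq[symmetric]] by blast
  qed
  moreover have "F ` mcoset M K ` mcarrier M = mcarrier N"
    unfolding image_image image[symmetric] by (rule image_cong) (simp_all add: F_coset)
  ultimately have "bij_betw F (mcarrier (sn_quotient M K)) (mcarrier N)"
    by (simp add: bij_betw_def sn_quotient_def)
  moreover have "F (madd (sn_quotient M K) A B) = madd N (F A) (F B)"
    if AB: "A \<in> mcarrier (sn_quotient M K)" "B \<in> mcarrier (sn_quotient M K)" for A B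
  proof -
    from AB obtain a b where a: "a \<in> mcarrier M" "A = mcoset M K a"
      and b: "b \<in> mcarrier M" "B = mcoset M K b"
      by (auto simp: sn_quotient_def)
    have "F (\<Union>x\<in>A. \<Union>y\<in>B. mcoset M K (x + y)) = h a + h b"
      by (rule F[of "a + b"]) (use a b self in \<open>auto simp: add dest!: h_coset\<close>)
    then show ?thesis
      by (simp add: sn_quotient_def madd a b F_coset)
  qed
  moreover have "F (mscale (sn_quotient M K) c A) = mscale N c (F A)"
    if A: "A \<in> mcarrier (sn_quotient M K)" for c A
  proof -
    from A obtain a where a: "a \<in> mcarrier M" "A = mcoset M K a"
      by (auto simp: sn_quotient_def)
    have "F (\<Union>x\<in>A. mcoset M K (mscale M c x)) = mscale N c (h a)"
    proof (rule F[of "mscale M c a"])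
      show "mscale M c a \<in> (\<Union>x\<in>A. mcoset M K (mscale M c x))"
        using a self[OF a(1)] by blast
      show "h y = mscale N c (h a)" if "y \<in> (\<Union>x\<in>A. mcoset M K (mscale M c x))" for y
        using that a h_coset coset_carrier scale by (metis UN_E)
    qed
    then show ?thesis
      by (simp add: sn_quotient_def a F_coset)
  qed
  moreover have "F (mact (sn_quotient M K) \<sigma> A) = mact N \<sigma> (F A)"
    if \<sigma>: "\<sigma> permutes {..<n}" and A: "A \<in> mcarrier (sn_quotient M K)" for \<sigma> A
  proof -
    from A obtain a where a: "a \<in> mcarrier M" "A = mcoset M K a"
      by (auto simp: sn_quotient_def)
    have "F (\<Union>x\<in>A. mcoset M K (mact M \<sigma> x)) = mact N \<sigma> (h a)"
    proof (rule F[of "mact M \<sigma> a"])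
      show "mact M \<sigma> a \<in> (\<Union>x\<in>A. mcoset M K (mact M \<sigma> x))"
        using a self[OF a(1)] by blast
      show "h y = mact N \<sigma> (h a)" if "y \<in> (\<Union>x\<in>A. mcoset M K (mact M \<sigma> x))" for y
        using that a h_coset coset_carrier act[OF \<sigma>] by (metis UN_E)
    qed
    then show ?thesis
      by (simp add: sn_quotient_def a F_coset)
  qed
  ultimately show ?thesis
    unfolding sn_isomorphic_def by blast
qed

theorem theorem2p25:
  fixes n :: nat
  assumes "n \<ge> 1"
  shows "sn_isomorphic n
    (comodule n (galg_scale :: 'c::{comm_ring, comm_monoid_mult} \<Rightarrow> 'c galg \<Rightarrow> 'c galg))
    (gen_signs n)"
  unfolding comodule_def
proof (rule sn_first_isomorphism[where h = sgn_map])
  show "madd (multilinear n) = ((+) :: 'c free_alg \<Rightarrow> _)" "madd (gen_signs n) = ((+) :: 'c ceps \<Rightarrow> _)"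
    by (simp_all add: multilinear_def gen_signs_def sn_generated_def ceps_module_def)
  show "sgn_map ` mcarrier (multilinear n) = mcarrier (gen_signs n :: ('c, _) sn_module)"
    by (rule sgn_map_image)
  show "f \<in> poly_ids galg_scale \<inter> mcarrier (multilinear n)
      \<longleftrightarrow> f \<in> mcarrier (multilinear n) \<and> sgn_map f = 0" for f :: "'c free_alg"
    by (auto simp: mcarrier_multilinear ml_poly_in_poly_ids_iff)
  show "sgn_map (mact (multilinear n) \<sigma> f) = mact (gen_signs n) \<sigma> (sgn_map f)"
    if "\<sigma> permutes {..<n}" "f \<in> mcarrier (multilinear n)" for \<sigma> and f :: "'c free_alg"
    using that
    by (auto simp: mcarrier_multilinear ml_poly_act sgn_map_act)
      (simp add: multilinear_def gen_signs_def sn_generated_def ceps_module_def ml_poly_act sgn_map_act)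
  show "sgn_map (mscale (multilinear n) c f) = mscale (gen_signs n) c (sgn_map f)"
    if "f \<in> mcarrier (multilinear n)" for c and f :: "'c free_alg"
    using that
    by (auto simp: mcarrier_multilinear)
      (simp add: multilinear_def gen_signs_def sn_generated_def ceps_module_def ml_poly_scale sgn_map_scale)
qed (auto simp: mcarrier_multilinear ml_poly_add ml_poly_diff sgn_map_add)

end
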